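(* Let $(\mathcal{C},\bm{\theta}_{\mathcal{C}})$ be a chain event graph (CEG) subject to a stochastic manipulation with intervened positions $\bm{w}^*$ and post-intervention transition probabilities $\bm{\hat\theta}_{\bm{w}^*}$, and let $y$ be a d-event. The effects of the stochastic manipulation are identifiable whenever a back-door partition $\{\Lambda_z\}$ can be found so that $$\pi(\Lambda_y||\bm{\hat{\theta}}_{\bm{w}^*})=\sum_{x\in x(E(\bm{w}^* ))}\sum_{z}\pi^{\Lambda(\bm{w}^* )}(\Lambda_y|\Lambda_x,\Lambda_z)\,\pi^{\Lambda(\bm{w}^* )}(\Lambda_z)\,\hat{\pi}^{\Lambda(\bm{w}^* )}(\Lambda_x).$$ This holds when $$\pi^{\Lambda(\bm{w}^* )}(\Lambda_y|\hat{\Lambda}_x,\Lambda_z)=\pi^{\Lambda(\bm{w}^* )}(\Lambda_y|\Lambda_x,\Lambda_z),$$ where $\hat\Lambda_x$ denotes that there is a singular intervention on $\Lambda_x$ only, not on $\Lambda_z$, and $$\pi^{\Lambda(\bm{w}^* )}(\Lambda_z||\Lambda_x)=\pi^{\Lambda(\bm{w}^* )}(\Lambda_z).$$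
   Context: **CEG.** A finite event tree $\mathcal{T}$ is a finite directed rooted tree whose edges carry labels $x(e)$, called d-events. A probability tree assigns to each non-leaf vertex (situation) $v$ a vector $\bm{\theta}_v=(\theta_{v,v'})_{v'\in ch(v)}$ with $\theta_{v,v'}\in(0,1)$ and $\sum_{v'\in ch(v)}\theta_{v,v'}=1$ ($ch$ denotes children, $pa$ parents). Two situations are in the same stage if their emanating edges carry the same set of d-events and equally labelled edges have equal probabilities. Stages are represented by colours. Two situations in the same stage are in the same position if the coloured subtrees rooted at them are isomorphic. The CEG $(\mathcal{C},\bm{\theta}_{\mathcal{C}})$ has as vertices the set $W$ of positions together with two sinks: $w_\infty^f$, which merges the leaves labelled "fail", and $w_\infty^n$, which merges the remaining leaves. Its edges are inherited from the tree with their labels and probabilities; parallel edges are possible. The root is $w_0$, and $\Lambda_{\mathcal{C}}$ is the set of root-to-sink paths. The floret $\mathcal{F}(w)$ consists of $w$, its children and its set $E(w)$ of emanating edges. For a path $\lambda$, $E_\lambda$ and $W_\lambda$ are its sets of edges and vertices. The path probability is $\pi(\lambda)=\prod_{e\in E_\lambda}\theta_e$, extended additively to sets of paths. $\Lambda(w)$ and $\Lambda(e)$ are the sets of root-to-sink paths through the vertex $w$ and the edge $e$. For a d-event $x$, $e(x)$ is the set of edges labelled $x$, and $\Lambda_x$ is the set of root-to-sink paths traversing an edge labelled $x$. Conditional probabilities such as $\pi(A|B,C)$ for sets of paths mean $\pi(A\cap B\cap C)/\pi(B\cap C)$. The unmanipulated CEG is called idle. **Stochastic manipulation.** Let $\bm{w}^*\subseteq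 W$ be the intervened positions, $\Lambda(\bm{w}^* )=\cup_{w\in\bm{w}^*}\Lambda(w)$ the intervened paths, $E(\bm{w}^* )=\cup_{w\in\bm{w}^*}E(w)$, and $x(E(\bm{w}^* ))=\{x(e):e\in E(\bm{w}^* )\}$ the intervened d-events. A manipulation is stochastic if the following hold. 1. For each $w\in\bm{w}^*$ there is a well-defined map $\Gamma:\bm{\theta}_w\mapsto\bm{\hat\theta}_w=(\hat\theta_{w,w'})_{w'\in ch(w)}$. 2. $\bm{\hat\theta}_w\ne\bm{\theta}_w$, $\hat\theta_{w,w'}\in(0,1)$ and $\sum_{w'\in ch(w)}\hat\theta_{w,w'}=1$. 3. $\bm{\hat\theta}_w=\bm{\theta}_w$ for every non-intervened position $w$ lying on a path of $\Lambda(\bm{w}^* )$. 4. $\hat\theta_{pa(w'),w'}=0$ for every $w'\in ch(pa(\bm{w}^* ))\setminus\bm{w}^*$. Write $\bm{\hat\theta}_{\bm{w}^*}=(\bm{\hat\theta}_w)_{w\in\bm{w}^*}$. The post-intervention path probability is $$\hat\pi(\lambda)=\frac{\prod_{e\in E_\lambda}\theta_e}{\prod_{e'\in E(\bm{w}^* )\cap E_\lambda}\theta_{e'}}\prod_{e'\in E(\bm{w}^* )\cap E_\lambda}\hat\theta_{e'}$$ for $\lambda\in\Lambda(\bm{w}^* )$, and $0$ otherwise. Both $\bm{w}^*$ and $ch(\bm{w}^* )$ form fine cuts of $\Lambda(\bm{w}^* )$, meaning that the paths through their vertices make up $\Lambda(\bm{w}^* )$. **Conditioning on intervened paths.** The conditioned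 CEG $(\mathcal{C}^{\Lambda(\bm{w}^* )},\bm{\theta}^* )$ consists of the vertices and edges traversed by paths in $\Lambda(\bm{w}^* )$, with (pre-intervention) transition probabilities $$\pi^{\Lambda(\bm{w}^* )}(w_j|w_i)=\frac{\sum_{\lambda\in\Lambda(\bm{w}^* )}\pi(\lambda,\Lambda(e_{w_i,w_j}))}{\sum_{\lambda\in\Lambda(\bm{w}^* )}\pi(\lambda,\Lambda(w_i))}.$$ $\pi^{\Lambda(\bm{w}^* )}(\cdot)$ denotes its path probabilities. Similarly, $\hat\pi^{\Lambda(\bm{w}^* )}(\lambda)$ is the product along $\lambda$ of the same ratios with $\pi$ replaced by $\hat\pi$. The probabilities $\hat\pi^{\Lambda(\bm{w}^* )}(\Lambda_x)$ are regarded as known once $\bm{\hat\theta}_{\bm{w}^*}$ is given. **Singular manipulation.** $\pi^{\Lambda(\bm{w}^* )}(\cdot\,||\Lambda_x)$ denotes probability in the conditioned CEG under the singular manipulation that forces $\Lambda_x$ to be traversed. That is, at positions $w\in\bm{w}^*$ the edge labelled $x$ receives probability one and the other edges of the floret probability zero, with all other transition probabilities unchanged. In terms of the conditioned CEG, $$\pi^{\Lambda(\bm{w}^* )}(\Lambda_y||\Lambda_x)=\sum_{w\in\bm{w}^*,\ e_{w,w'}\in e(x)}\pi^{\Lambda(\bm{w}^* )}(\Lambda(w))\,\pi^{\Lambda(\bm{w}^* )}(\Lambda_y|\Lambda(e_{w,w'})).$$ $\pi^{\Lambda(\bm{w}^* )}(\Lambda_y|\hat\Lambda_x,\Lambda_z)$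 is the conditional probability of $\Lambda_y$ given $\Lambda_z$ under this singular manipulation, so that $\pi^{\Lambda(\bm{w}^* )}(\Lambda_y||\Lambda_x)=\sum_z\pi^{\Lambda(\bm{w}^* )}(\Lambda_y|\hat\Lambda_x,\Lambda_z)\,\pi^{\Lambda(\bm{w}^* )}(\Lambda_z||\Lambda_x)$ for a partition $\{\Lambda_z\}$ of $\Lambda(\bm{w}^* )$. **Causal effect of a stochastic manipulation.** The effect of $\bm{\hat\theta}_{\bm{w}^*}$ on $y$ is $$\pi(\Lambda_y||\bm{\hat{\theta}}_{\bm{w}^*})=\sum_{x\in x(E(\bm{w}^* ))}\pi^{\Lambda(\bm{w}^* )}(\Lambda_y||\Lambda_x)\,\hat{\pi}^{\Lambda(\bm{w}^* )}(\Lambda_x).$$ It is identifiable if it is uniquely determined (estimable) from the idle CEG and the observable information, given $\bm{\hat\theta}_{\bm{w}^*}$. **Back-door partition.** A partition $\{\Lambda_z\}$ of $\Lambda(\bm{w}^* )$ is a back-door partition (for identifying the effects of the intervention) if, for any $w\in\bm{w}^*$, for all $x\in x(E(\bm{w}^* ))$ and any $e_{w,w'}\in e(x)$, the two equalities $$\pi^{\Lambda(\bm{w}^* )}(\Lambda_z|\Lambda(w)) = \pi^{\Lambda(\bm{w}^* )}(\Lambda_z|\Lambda(e_{w,w'}))$$ and $$\pi^{\Lambda(\bm{w}^* )}(\Lambda_{y}|\Lambda(w),\Lambda_x,\Lambda_z) = \pi^{\Lambda(\bm{w}^* )}(\Lambda_{y}|\Lambda(e_{w,w'}),\Lambda_z)$$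 hold for every element $\Lambda_z$ of the partition. *)

theory Defs
  imports
    Complex_Main
    "HOL-Library.FuncSet"
    "HOL-Library.Disjoint_Sets"
    "Graph_Theory.Digraph_Isomorphism"
begin

section \<open>Rooted labelled digraphs and their root-to-sink paths\<close>

text \<open>Event trees and chain event graphs are both rooted directed graphs, possibly with parallel
  arcs, whose arcs \<open>e\<close> carry d-events \<open>devent D e\<close>.\<close>

record ('v, 'e, 'x) ldigraph =
  graph :: "('v, 'e) pre_digraph"
  root :: 'v
  devent :: "'e \<Rightarrow> 'x"

text \<open>The internal vertices are the situations of an event tree and the positions of a CEG; the
  terminal vertices are the leaves of an event tree and the sinks of a CEG.\<close>

definition internal :: "('v, 'e, 'x, 'm) ldigraph_scheme \<Rightarrow> 'v set" where
  "internal D = {v \<in> verts (graph D). out_arcs (graph D) v \<noteq> {}}"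

definition terminal :: "('v, 'e, 'x, 'm) ldigraph_scheme \<Rightarrow> 'v set" where
  "terminal D = {v \<in> verts (graph D). out_arcs (graph D) v = {}}"

text \<open>A path \<open>\<lambda>\<close> is the list of its arcs, so that \<open>E\<^sub>\<lambda>\<close> is \<open>set p\<close>.\<close>

definition paths :: "('v, 'e, 'x, 'm) ldigraph_scheme \<Rightarrow> 'e list set" where
  "paths D = {p. \<exists>s \<in> terminal D. pre_digraph.awalk (graph D) (root D) p s}"

definition path_verts :: "('v, 'e, 'x, 'm) ldigraph_scheme \<Rightarrow> 'e list \<Rightarrow> 'v set" where
  "path_verts D p = set (pre_digraph.awalk_verts (graph D) (root D) p)"

definition through_vertex :: "('v, 'e, 'x, 'm) ldigraph_scheme \<Rightarrow> 'v \<Rightarrow> 'e list set" where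
  "through_vertex D w = {p \<in> paths D. w \<in> path_verts D p}"

definition through_edge :: "('v, 'e, 'x, 'm) ldigraph_scheme \<Rightarrow> 'e \<Rightarrow> 'e list set" where
  "through_edge D e = {p \<in> paths D. e \<in> set p}"

definition through_devent :: "('v, 'e, 'x, 'm) ldigraph_scheme \<Rightarrow> 'x \<Rightarrow> 'e list set" where
  "through_devent D x = {p \<in> paths D. \<exists>e \<in> set p. devent D e = x}"


section \<open>Probability trees, stages and positions\<close>

record ('v, 'e, 'x) event_tree = "('v, 'e, 'x) ldigraph" +
  fail_leaves :: "'v set"

text \<open>A rooted tree is a digraph in which every vertex is reached from the root by exactly one
  walk. The edges of one floret carry pairwise different d-events.\<close>

definition event_tree :: "('v, 'e, 'x) event_tree \<Rightarrow> bool" where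
  "event_tree T \<longleftrightarrow>
     fin_digraph (graph T) \<and> root T \<in> verts (graph T) \<and>
     (\<forall>v \<in> verts (graph T). \<exists>!p. pre_digraph.awalk (graph T) (root T) p v) \<and>
     (\<forall>v \<in> internal T. inj_on (devent T) (out_arcs (graph T) v)) \<and>
     fail_leaves T \<subseteq> terminal T"

definition probability_tree :: "('v, 'e, 'x) event_tree \<Rightarrow> ('e \<Rightarrow> real) \<Rightarrow> bool" where
  "probability_tree T \<theta> \<longleftrightarrow>
     event_tree T \<and>
     (\<forall>v \<in> internal T. (\<forall>a \<in> out_arcs (graph T) v. 0 < \<theta> a \<and> \<theta> a < 1) \<and>
                       (\<Sum>a \<in> out_arcs (graph T) v. \<theta> a) = 1)"

definition same_stage :: "('v, 'e, 'x) event_tree \<Rightarrow> ('e \<Rightarrow> real) \<Rightarrow> 'v \<Rightarrow> 'v \<Rightarrow> bool" where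
  "same_stage T \<theta> u v \<longleftrightarrow>
     u \<in> internal T \<and> v \<in> internal T \<and>
     devent T ` out_arcs (graph T) u = devent T ` out_arcs (graph T) v \<and>
     (\<forall>a \<in> out_arcs (graph T) u. \<forall>b \<in> out_arcs (graph T) v. devent T a = devent T b \<longrightarrow> \<theta> a = \<theta> b)"

definition subtree :: "('v, 'e, 'x) event_tree \<Rightarrow> 'v \<Rightarrow> ('v, 'e) pre_digraph" where
  "subtree T v = induce_subgraph (graph T) {u. reachable (graph T) v u}"

text \<open>Isomorphisms of coloured subtrees respect the stages, the d-events and the distinction
  between the leaves labelled fail and the other leaves. The latter two are needed for the edges
  and sinks of the CEG to be inherited consistently from the tree.\<close>

definition coloured_iso ::
  "('v, 'e, 'x) event_tree \<Rightarrow> ('e \<Rightarrow> real) \<Rightarrow> ('v, 'e, 'v, 'e) digraph_isomorphism \<Rightarrow> 'v \<Rightarrow> 'v \<Rightarrow> bool"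
  where
  "coloured_iso T \<theta> \<phi> u v \<longleftrightarrow>
     pre_digraph.digraph_isomorphism (subtree T u) \<phi> \<and>
     app_iso \<phi> (subtree T u) = subtree T v \<and>
     iso_verts \<phi> u = v \<and>
     (\<forall>a \<in> arcs (subtree T u). devent T (iso_arcs \<phi> a) = devent T a) \<and>
     (\<forall>s \<in> verts (subtree T u) \<inter> internal T. same_stage T \<theta> s (iso_verts \<phi> s)) \<and>
     (\<forall>l \<in> verts (subtree T u) \<inter> terminal T. iso_verts \<phi> l \<in> fail_leaves T \<longleftrightarrow> l \<in> fail_leaves T)"

definition same_position :: "('v, 'e, 'x) event_tree \<Rightarrow> ('e \<Rightarrow> real) \<Rightarrow> 'v \<Rightarrow> 'v \<Rightarrow> bool" where
  "same_position T \<theta> u v \<longleftrightarrow> same_stage T \<theta> u v \<and> (\<exists>\<phi>. coloured_iso T \<theta> \<phi> u v)"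


section \<open>The chain event graph of a probability tree\<close>

datatype 'v ceg_vertex = Position "'v set" | Fail_Sink | Nonfail_Sink

definition ceg_vertex_of ::
  "('v, 'e, 'x) event_tree \<Rightarrow> ('e \<Rightarrow> real) \<Rightarrow> 'v \<Rightarrow> 'v ceg_vertex" where
  "ceg_vertex_of T \<theta> v =
     (if v \<in> internal T then Position {u. same_position T \<theta> v u}
      else if v \<in> fail_leaves T then Fail_Sink else Nonfail_Sink)"

text \<open>An edge of the CEG is the class of all tree edges that leave the same position with the
  same d-event; two positions or sinks may be joined by several such classes. Head, tail, d-event
  and probability of a class are read off any of its members.\<close>

definition ceg_edge_of :: "('v, 'e, 'x) event_tree \<Rightarrow> ('e \<Rightarrow> real) \<Rightarrow> 'e \<Rightarrow> 'e set" where
  "ceg_edge_of T \<theta> a =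
     {b \<in> arcs (graph T). same_position T \<theta> (tail (graph T) a) (tail (graph T) b) \<and>
                          devent T b = devent T a}"

definition ceg ::
  "('v, 'e, 'x) event_tree \<Rightarrow> ('e \<Rightarrow> real) \<Rightarrow> ('v ceg_vertex, 'e set, 'x) ldigraph" where
  "ceg T \<theta> =
     \<lparr>graph =
        \<lparr>verts = ceg_vertex_of T \<theta> ` internal T \<union> {Fail_Sink, Nonfail_Sink},
         arcs = ceg_edge_of T \<theta> ` arcs (graph T),
         tail = (\<lambda>c. ceg_vertex_of T \<theta> (tail (graph T) (SOME a. a \<in> c))),
         head = (\<lambda>c. ceg_vertex_of T \<theta> (head (graph T) (SOME a. a \<in> c)))\<rparr>,
      root = ceg_vertex_of T \<theta> (root T),
      devent = (\<lambda>c. devent T (SOME a. a \<in> c))\<rparr>"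

definition ceg_prob :: "('e \<Rightarrow> real) \<Rightarrow> 'e set \<Rightarrow> real" where
  "ceg_prob \<theta> c = \<theta> (SOME a. a \<in> c)"


section \<open>Stochastic manipulations\<close>

definition intervened_paths :: "('v, 'e, 'x) ldigraph \<Rightarrow> 'v set \<Rightarrow> 'e list set" where
  "intervened_paths C ws = (\<Union>w \<in> ws. through_vertex C w)"

definition intervened_edges :: "('v, 'e, 'x) ldigraph \<Rightarrow> 'v set \<Rightarrow> 'e set" where
  "intervened_edges C ws = (\<Union>w \<in> ws. out_arcs (graph C) w)"

definition intervened_devents :: "('v, 'e, 'x) ldigraph \<Rightarrow> 'v set \<Rightarrow> 'x set" where
  "intervened_devents C ws = devent C ` intervened_edges C ws"

definition children :: "('v, 'e, 'x) ldigraph \<Rightarrow> 'v set \<Rightarrow> 'v set" where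
  "children C ws = head (graph C) ` intervened_edges C ws"

definition parents :: "('v, 'e, 'x) ldigraph \<Rightarrow> 'v set \<Rightarrow> 'v set" where
  "parents C ws = tail (graph C) ` {e \<in> arcs (graph C). head (graph C) e \<in> ws}"

definition fine_cut :: "('v, 'e, 'x) ldigraph \<Rightarrow> 'e list set \<Rightarrow> 'v set \<Rightarrow> bool" where
  "fine_cut C \<Lambda> U \<longleftrightarrow> (\<Union>u \<in> U. through_vertex C u) = \<Lambda>"

text \<open>The edges that leave a parent of an intervened position without entering one.\<close>

definition blocked_edges :: "('v, 'e, 'x) ldigraph \<Rightarrow> 'v set \<Rightarrow> 'e set" where
  "blocked_edges C ws =
     {e \<in> arcs (graph C). tail (graph C) e \<in> parents C ws \<and> head (graph C) e \<notin> ws}"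

text \<open>\<open>\<theta>h\<close> stands for the post-intervention transition probabilities, written with a hat. They
  coincide with \<open>\<theta>\<close> at the non-intervened positions of the intervened paths, except on the
  blocked edges, where they vanish although \<open>\<theta>\<close> is positive.\<close>

definition stochastic_manipulation ::
  "('v, 'e, 'x) ldigraph \<Rightarrow> ('e \<Rightarrow> real) \<Rightarrow> ('e \<Rightarrow> real) \<Rightarrow> 'v set \<Rightarrow> bool" where
  "stochastic_manipulation C \<theta> \<theta>h ws \<longleftrightarrow>
     ws \<subseteq> internal C \<and>
     fine_cut C (intervened_paths C ws) ws \<and>
     fine_cut C (intervened_paths C ws) (children C ws) \<and>
     (\<exists>\<Gamma>. \<forall>w \<in> ws. restrict \<theta>h (out_arcs (graph C) w) = \<Gamma> w (restrict \<theta> (out_arcs (graph C) w))) \<and>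
     (\<forall>w \<in> ws. (\<exists>e \<in> out_arcs (graph C) w. \<theta>h e \<noteq> \<theta> e) \<and>
               (\<forall>e \<in> out_arcs (graph C) w. 0 < \<theta>h e \<and> \<theta>h e < 1) \<and>
               (\<Sum>e \<in> out_arcs (graph C) w. \<theta>h e) = 1) \<and>
     (\<forall>w \<in> internal C - ws. (\<exists>p \<in> intervened_paths C ws. w \<in> path_verts C p) \<longrightarrow>
        (\<forall>e \<in> out_arcs (graph C) w - blocked_edges C ws. \<theta>h e = \<theta> e)) \<and>
     (\<forall>e \<in> blocked_edges C ws. \<theta>h e = 0)"

definition path_prob :: "('e \<Rightarrow> real) \<Rightarrow> 'e list \<Rightarrow> real" where
  "path_prob \<theta> p = (\<Prod>e \<in> set p. \<theta> e)"

definition post_path_prob ::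
  "('v, 'e, 'x) ldigraph \<Rightarrow> ('e \<Rightarrow> real) \<Rightarrow> ('e \<Rightarrow> real) \<Rightarrow> 'v set \<Rightarrow> 'e list \<Rightarrow> real" where
  "post_path_prob C \<theta> \<theta>h ws p =
     (if p \<in> intervened_paths C ws
      then (\<Prod>e \<in> set p. \<theta> e) / (\<Prod>e \<in> intervened_edges C ws \<inter> set p. \<theta> e)
             * (\<Prod>e \<in> intervened_edges C ws \<inter> set p. \<theta>h e)
      else 0)"


section \<open>The CEG conditioned on the intervened paths\<close>

definition conditioned_ceg :: "('v, 'e, 'x) ldigraph \<Rightarrow> 'v set \<Rightarrow> ('v, 'e, 'x) ldigraph" where
  "conditioned_ceg C ws =
     C\<lparr>graph := \<lparr>verts = (\<Union>p \<in> intervened_paths C ws. path_verts C p),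
                 arcs = (\<Union>p \<in> intervened_paths C ws. set p),
                 tail = tail (graph C),
                 head = head (graph C)\<rparr>\<rparr>"

text \<open>The path weights \<open>\<mu>\<close> are the idle ones for \<open>\<pi>\<close> and the post-intervention ones for the
  hatted \<open>\<pi>\<close>.\<close>

definition cond_transition ::
  "('v, 'e, 'x) ldigraph \<Rightarrow> 'v set \<Rightarrow> ('e list \<Rightarrow> real) \<Rightarrow> 'e \<Rightarrow> real" where
  "cond_transition C ws \<mu> e =
     (\<Sum>p \<in> intervened_paths C ws \<inter> through_edge C e. \<mu> p) /
     (\<Sum>p \<in> intervened_paths C ws \<inter> through_vertex C (tail (graph C) e). \<mu> p)"

definition cond_event_prob ::
  "('v, 'e, 'x) ldigraph \<Rightarrow> 'v set \<Rightarrow> ('e list \<Rightarrow> real) \<Rightarrow> 'e list set \<Rightarrow> real" where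
  "cond_event_prob C ws \<mu> A =
     (\<Sum>p \<in> A \<inter> paths (conditioned_ceg C ws). \<Prod>e \<in> set p. cond_transition C ws \<mu> e)"

definition pre_prob :: "('v, 'e, 'x) ldigraph \<Rightarrow> ('e \<Rightarrow> real) \<Rightarrow> 'v set \<Rightarrow> 'e list set \<Rightarrow> real" where
  "pre_prob C \<theta> ws A = cond_event_prob C ws (path_prob \<theta>) A"

definition post_prob ::
  "('v, 'e, 'x) ldigraph \<Rightarrow> ('e \<Rightarrow> real) \<Rightarrow> ('e \<Rightarrow> real) \<Rightarrow> 'v set \<Rightarrow> 'e list set \<Rightarrow> real" where
  "post_prob C \<theta> \<theta>h ws A = cond_event_prob C ws (post_path_prob C \<theta> \<theta>h ws) A"

definition pre_cond ::
  "('v, 'e, 'x) ldigraph \<Rightarrow> ('e \<Rightarrow> real) \<Rightarrow> 'v set \<Rightarrow> 'e list set \<Rightarrow> 'e list set \<Rightarrow> real" where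
  "pre_cond C \<theta> ws A B = pre_prob C \<theta> ws (A \<inter> B) / pre_prob C \<theta> ws B"


section \<open>Singular manipulations and causal effects\<close>

text \<open>\<open>\<pi>(A || \<Lambda>\<^sub>x)\<close>: the \<open>x\<close>-edge is followed with probability one at the intervened positions,
  all other transitions being those of the conditioned CEG.\<close>

definition singular_prob ::
  "('v, 'e, 'x) ldigraph \<Rightarrow> ('e \<Rightarrow> real) \<Rightarrow> 'v set \<Rightarrow> 'x \<Rightarrow> 'e list set \<Rightarrow> real" where
  "singular_prob C \<theta> ws x A =
     (\<Sum>w \<in> ws. \<Sum>e \<in> {e \<in> out_arcs (graph C) w. devent C e = x}.
        pre_prob C \<theta> ws (through_vertex C w) * pre_cond C \<theta> ws A (through_edge C e))"

definition singular_cond ::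
  "('v, 'e, 'x) ldigraph \<Rightarrow> ('e \<Rightarrow> real) \<Rightarrow> 'v set \<Rightarrow> 'x \<Rightarrow> 'e list set \<Rightarrow> 'e list set \<Rightarrow> real" where
  "singular_cond C \<theta> ws x A B = singular_prob C \<theta> ws x (A \<inter> B) / singular_prob C \<theta> ws x B"

definition causal_effect ::
  "('v, 'e, 'x) ldigraph \<Rightarrow> ('e \<Rightarrow> real) \<Rightarrow> ('e \<Rightarrow> real) \<Rightarrow> 'v set \<Rightarrow> 'x \<Rightarrow> real" where
  "causal_effect C \<theta> \<theta>h ws y =
     (\<Sum>x \<in> intervened_devents C ws.
        singular_prob C \<theta> ws x (through_devent C y) * post_prob C \<theta> \<theta>h ws (through_devent C x))"


section \<open>Back-door partitions and identifiability\<close>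

definition backdoor_partition ::
  "('v, 'e, 'x) ldigraph \<Rightarrow> ('e \<Rightarrow> real) \<Rightarrow> 'v set \<Rightarrow> 'x \<Rightarrow> 'e list set set \<Rightarrow> bool" where
  "backdoor_partition C \<theta> ws y Z \<longleftrightarrow>
     partition_on (intervened_paths C ws) Z \<and>
     (\<forall>w \<in> ws. \<forall>x \<in> intervened_devents C ws. \<forall>e \<in> out_arcs (graph C) w. devent C e = x \<longrightarrow>
        (\<forall>\<Lambda>z \<in> Z.
           pre_cond C \<theta> ws \<Lambda>z (through_vertex C w) = pre_cond C \<theta> ws \<Lambda>z (through_edge C e) \<and>
           pre_cond C \<theta> ws (through_devent C y) (through_vertex C w \<inter> through_devent C x \<inter> \<Lambda>z) =
           pre_cond C \<theta> ws (through_devent C y) (through_edge C e \<inter> \<Lambda>z)))"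

definition backdoor_adjustment ::
  "('v, 'e, 'x) ldigraph \<Rightarrow> ('e \<Rightarrow> real) \<Rightarrow> ('e \<Rightarrow> real) \<Rightarrow> 'v set \<Rightarrow> 'x \<Rightarrow> 'e list set set \<Rightarrow> real"
  where
  "backdoor_adjustment C \<theta> \<theta>h ws y Z =
     (\<Sum>x \<in> intervened_devents C ws. \<Sum>\<Lambda>z \<in> Z.
        pre_cond C \<theta> ws (through_devent C y) (through_devent C x \<inter> \<Lambda>z) * pre_prob C \<theta> ws \<Lambda>z *
        post_prob C \<theta> \<theta>h ws (through_devent C x))"

lemma ceg_cong:
  assumes "same_stage T \<theta>' = same_stage T \<theta>"
  shows "ceg T \<theta>' = ceg T \<theta>"
proof -
  have "coloured_iso T \<theta>' = coloured_iso T \<theta>"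
    by (intro ext) (simp add: coloured_iso_def assms)
  then have "same_position T \<theta>' = same_position T \<theta>"
    by (intro ext) (simp add: same_position_def assms)
  then have "ceg_vertex_of T \<theta>' = ceg_vertex_of T \<theta>" "ceg_edge_of T \<theta>' = ceg_edge_of T \<theta>"
    by (auto simp: ceg_vertex_of_def ceg_edge_of_def fun_eq_iff)
  then show ?thesis
    by (simp add: ceg_def)
qed

text \<open>The transition probabilities that give rise to the same coloured graph, hence to the same
  CEG up to the values of the probabilities (see \<open>ceg_cong\<close>), and for which the given values \<open>\<theta>h\<close> on the florets of
  the intervened positions extend to a stochastic manipulation. Only these values of \<open>\<theta>h\<close> are
  kept, because elsewhere \<open>\<theta>h\<close> depends on the idle probabilities.\<close>

definition compatible_params ::
  "('v, 'e, 'x) event_tree \<Rightarrow> ('e \<Rightarrow> real) \<Rightarrow> ('e set \<Rightarrow> real) \<Rightarrow> 'v ceg_vertex set \<Rightarrow> ('e set \<Rightarrow> real) set"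
  where
  "compatible_params T \<theta> \<theta>h ws =
     {ceg_prob \<theta>' |\<theta>'. probability_tree T \<theta>' \<and> same_stage T \<theta>' = same_stage T \<theta> \<and>
        (\<exists>\<theta>h'. stochastic_manipulation (ceg T \<theta>) (ceg_prob \<theta>') \<theta>h' ws \<and>
               (\<forall>e \<in> intervened_edges (ceg T \<theta>) ws. \<theta>h' e = \<theta>h e))}"

text \<open>The model class \<open>K\<close> collects the transition probabilities considered possible for the idle
  CEG; \<open>Obs\<close> collects the path events whose pre-intervention probability, given the intervened
  paths, is observable. The effect is identifiable if it is the same for any two members of \<open>K\<close>
  that agree on the observable probabilities, and on the post-intervention probabilities of the
  intervened d-events, which are regarded as known along with \<open>\<theta>h\<close>.\<close>

definition identifiable ::
  "('v, 'e, 'x) ldigraph \<Rightarrow> ('e \<Rightarrow> real) set \<Rightarrow> ('e \<Rightarrow> real) \<Rightarrow> 'v set \<Rightarrow> 'x \<Rightarrow> 'e list set set \<Rightarrow> bool"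
  where
  "identifiable C K \<theta>h ws y Obs \<longleftrightarrow>
     (\<forall>\<theta>1 \<in> K. \<forall>\<theta>2 \<in> K.
        (\<forall>A \<in> Obs. pre_prob C \<theta>1 ws A = pre_prob C \<theta>2 ws A) \<and>
        (\<forall>x \<in> intervened_devents C ws.
           post_prob C \<theta>1 \<theta>h ws (through_devent C x) = post_prob C \<theta>2 \<theta>h ws (through_devent C x)) \<longrightarrow>
        causal_effect C \<theta>1 \<theta>h ws y = causal_effect C \<theta>2 \<theta>h ws y)"

text \<open>The joint events of \<open>\<Lambda>\<^sub>z\<close>, \<open>\<Lambda>\<^sub>x\<close> and \<open>\<Lambda>\<^sub>y\<close> that enter the adjustment formula are observable.\<close>

definition observable_partition ::
  "('v, 'e, 'x) ldigraph \<Rightarrow> 'v set \<Rightarrow> 'x \<Rightarrow> 'e list set set \<Rightarrow> 'e list set set \<Rightarrow> bool" where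
  "observable_partition C ws y Obs Z \<longleftrightarrow>
     (\<forall>\<Lambda>z \<in> Z. \<Lambda>z \<in> Obs \<and>
        (\<forall>x \<in> intervened_devents C ws.
           through_devent C x \<inter> \<Lambda>z \<in> Obs \<and>
           through_devent C y \<inter> through_devent C x \<inter> \<Lambda>z \<in> Obs))"

end

theory Submission
  imports Defs
begin

text \<open>Since every path through an edge that leaves an intervened position is intervened, the cells
  of a partition of the intervened paths split \<open>\<pi>(\<Lambda>\<^sub>y || \<Lambda>\<^sub>x)\<close> by the law of total probability. The
  two conditions then turn each summand into \<open>\<pi>(\<Lambda>\<^sub>y | \<Lambda>\<^sub>x, \<Lambda>\<^sub>z) \<pi>(\<Lambda>\<^sub>z)\<close>; cells of singular probability
  zero contribute nothing on either side. The sums involved are genuine because a CEG has only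
  finitely many root-to-sink paths: along its edges the subtrees get strictly smaller.\<close>

section \<open>Positions and the sizes of their subtrees\<close>

text \<open>The identity is a coloured isomorphism of the subtree. It respects stages because the
  d-events of one floret are pairwise different, so equally labelled edges of \<open>v\<close>
  coincide. This is what ensures that an edge class contains the edge that generates it.\<close>

lemma same_position_refl:
  assumes T: "event_tree T" and v: "v \<in> internal T"
  shows "same_position T \<theta> v v"
proof -
  interpret G: fin_digraph "graph T"
    using T by (simp add: event_tree_def)
  have inj: "inj_on (devent T) (out_arcs (graph T) u)" if "u \<in> internal T" for u
    using T that by (simp add: event_tree_def)
  have stage: "same_stage T \<theta> u u" if "u \<in> internal T" for u
    using inj[OF that] that by (auto simp: same_stage_def dest: inj_onD)
  \<comment> \<open>\<open>app_iso\<close> takes the head and tail maps of the image from the last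
    two fields. An induced subgraph keeps those of the tree, so this choice maps the subtree exactly
    to itself.\<close>
  define \<phi> where "\<phi> = \<lparr>iso_verts = id, iso_arcs = id, iso_head = head (graph T), iso_tail = tail (graph T)\<rparr>"
  have "induced_subgraph (subtree T v) (graph T)"
    unfolding subtree_def by (rule G.induced_induce) (auto dest: G.reachable_in_verts)
  then have "wf_digraph (subtree T v)"
    by (rule wf_digraphI_induced)
  then have "coloured_iso T \<theta> \<phi> v v"
    by (auto simp: coloured_iso_def \<phi>_def pre_digraph.digraph_isomorphism_def subtree_def
        app_iso_def stage induce_subgraph_def)
  with stage[OF v] show ?thesis
    by (auto simp: same_position_def)
qed

text \<open>A coloured isomorphism is a bijection on vertices. The size of the subtree is therefore
  an invariant of the position and can rank the vertices of the CEG.\<close>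

lemma same_position_card_subtree:
  assumes "same_position T \<theta> u v"
  shows "card (verts (subtree T u)) = card (verts (subtree T v))"
proof -
  obtain \<phi> where "inj_on (iso_verts \<phi>) (verts (subtree T u))"
    "app_iso \<phi> (subtree T u) = subtree T v"
    using assms
    by (auto simp: same_position_def coloured_iso_def pre_digraph.digraph_isomorphism_def)
  then show ?thesis
    by (metis card_image verts_app_iso)
qed

text \<open>If the head of \<open>a\<close> reached its tail, \<open>a\<close> would close a cycle,
  and running through it would give a second walk from the root to the tail, against uniqueness. So
  the tail belongs to its own subtree but not to that of the head.\<close>

lemma card_subtree_less:
  assumes T: "event_tree T" and a: "a \<in> arcs (graph T)"
  shows "card (verts (subtree T (head (graph T) a))) < card (verts (subtree T (tail (graph T) a)))"
proof -
  let ?G = "graph T"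
  interpret G: fin_digraph ?G
    using T by (simp add: event_tree_def)
  have unreachable: "\<not> reachable ?G (head ?G a) (tail ?G a)"
  proof
    assume "reachable ?G (head ?G a) (tail ?G a)"
    then obtain q where q: "G.awalk (head ?G a) q (tail ?G a)"
      by (auto simp: G.reachable_awalk)
    have ex1: "\<exists>!p. G.awalk (root T) p (tail ?G a)"
      using T a by (simp add: event_tree_def)
    then obtain p where p: "G.awalk (root T) p (tail ?G a)"
      by blast
    have "G.awalk (tail ?G a) (a # q) (tail ?G a)"
      using q a by (simp add: G.awalk_Cons_iff)
    with p have "G.awalk (root T) (p @ a # q) (tail ?G a)"
      by simp
    with ex1 p have "p @ a # q = p"
      by blast
    then show False
      by simp
  qed
  have step: "reachable ?G (tail ?G a) (head ?G a)"
    using a by (simp add: G.in_arcs_imp_in_arcs_ends)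
  have "verts (subtree T (head ?G a)) \<subset> verts (subtree T (tail ?G a))"
  proof (rule psubsetI)
    show "verts (subtree T (head ?G a)) \<subseteq> verts (subtree T (tail ?G a))"
      using G.reachable_trans[OF step] by (simp add: subtree_def subset_iff)
    have "tail ?G a \<in> verts (subtree T (tail ?G a))" "tail ?G a \<notin> verts (subtree T (head ?G a))"
      using unreachable a by (simp_all add: subtree_def)
    then show "verts (subtree T (head ?G a)) \<noteq> verts (subtree T (tail ?G a))"
      by blast
  qed
  moreover have "finite (verts (subtree T (tail ?G a)))"
    by (rule finite_subset[OF _ G.finite_verts]) (auto simp: subtree_def dest: G.reachable_in_verts)
  ultimately show ?thesis
    by (rule psubset_card_mono[rotated])
qed

section \<open>Edges and root-to-sink paths of the CEG\<close>

text \<open>By reflexivity an edge class is never empty, so the choice operator, through which all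
  its attributes are read off, picks a genuine tree edge.\<close>

lemma ceg_arc_representative:
  assumes T: "event_tree T" and c: "c \<in> arcs (graph (ceg T \<theta>))"
  shows "(SOME a. a \<in> c) \<in> arcs (graph T)"
proof -
  interpret G: fin_digraph "graph T"
    using T by (simp add: event_tree_def)
  obtain a where a: "a \<in> arcs (graph T)" and c: "c = ceg_edge_of T \<theta> a"
    using c by (auto simp: ceg_def)
  have "tail (graph T) a \<in> internal T"
    using a by (auto simp: internal_def)
  then have "a \<in> c"
    using a same_position_refl[OF T] by (simp add: c ceg_edge_of_def)
  then have "(SOME a. a \<in> c) \<in> c"
    by (rule someI)
  then show ?thesis
    by (simp add: c ceg_edge_of_def)
qed

text \<open>The representatives of consecutive CEG edges need not be adjacent in the tree: the head
  of the first and the tail of the second only share a position. That suffices, since the subtree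
  size drops along the first representative and does not change within a position.\<close>

lemma ceg_arcs_rank_less:
  assumes T: "event_tree T" and c: "c \<in> arcs (graph (ceg T \<theta>))" and d: "d \<in> arcs (graph (ceg T \<theta>))"
    and consec: "head (graph (ceg T \<theta>)) c = tail (graph (ceg T \<theta>)) d"
  shows "card (verts (subtree T (tail (graph T) (SOME a. a \<in> d))))
       < card (verts (subtree T (tail (graph T) (SOME a. a \<in> c))))"
proof -
  interpret G: fin_digraph "graph T"
    using T by (simp add: event_tree_def)
  let ?a = "SOME a. a \<in> c" and ?b = "SOME a. a \<in> d"
  let ?u = "head (graph T) ?a" and ?v = "tail (graph T) ?b"
  have arcs: "?a \<in> arcs (graph T)" "?b \<in> arcs (graph T)"
    using ceg_arc_representative[OF T] c d by auto
  then have v: "?v \<in> internal T"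
    by (auto simp: internal_def)
  have "ceg_vertex_of T \<theta> ?u = ceg_vertex_of T \<theta> ?v"
    using consec by (simp add: ceg_def)
  \<comment> \<open>As \<open>v\<close> is a situation, its CEG vertex is a \<open>Position\<close>.
    This rules out that \<open>u\<close> is a leaf, whose CEG vertex would be a sink.\<close>
  with v have "{u. same_position T \<theta> ?u u} = {u. same_position T \<theta> ?v u}"
    by (auto simp: ceg_vertex_of_def split: if_splits)
  with same_position_refl[OF T v, of \<theta>] have "same_position T \<theta> ?u ?v"
    by blast
  then show ?thesis
    using card_subtree_less[OF T arcs(1)] same_position_card_subtree by metis
qed

text \<open>The rank strictly decreases along a walk, so no edge can recur. With \<open>cas\<close>
  and the arc set in place of \<open>awalk\<close>, the induction passes to the tail of the list
  without a check that intermediate heads are vertices.\<close>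

lemma ceg_walk_distinct:
  assumes T: "event_tree T"
    and "set p \<subseteq> arcs (graph (ceg T \<theta>))" "pre_digraph.cas (graph (ceg T \<theta>)) u p v"
  shows "distinct p"
proof -
  define r where "r c = card (verts (subtree T (tail (graph T) (SOME a. a \<in> c))))" for c
  have "sorted_wrt (\<lambda>c d. r d < r c) p"
    using assms(2,3)
  proof (induction p arbitrary: u)
    case (Cons c p)
    then have tl: "sorted_wrt (\<lambda>c d. r d < r c) p"
      by (auto simp: pre_digraph.cas.simps)
    show ?case
    proof (cases p)
      case (Cons d q)
      then have "r d < r c"
        using Cons.prems ceg_arcs_rank_less[OF T, of c \<theta> d]
        by (simp add: r_def pre_digraph.cas.simps)
      \<comment> \<open>By \<open>tl\<close> every edge after \<open>d\<close> ranks below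
        \<open>d\<close>, hence below \<open>c\<close>.\<close>
      with tl Cons show ?thesis
        by auto
    qed simp
  qed simp
  then show ?thesis
    by (induction p) auto
qed

lemma finite_paths_ceg:
  assumes T: "event_tree T"
  shows "finite (paths (ceg T \<theta>))"
proof (rule finite_subset)
  interpret G: fin_digraph "graph T"
    using T by (simp add: event_tree_def)
  show "paths (ceg T \<theta>) \<subseteq> {p. set p \<subseteq> arcs (graph (ceg T \<theta>)) \<and> distinct p}"
    using ceg_walk_distinct[OF T] by (auto simp: paths_def pre_digraph.awalk_def)
  have "finite (arcs (graph (ceg T \<theta>)))"
    by (simp add: ceg_def)
  then show "finite {p. set p \<subseteq> arcs (graph (ceg T \<theta>)) \<and> distinct p}"
    by (rule finite_subset_distinct)
qed

lemma ceg_prob_pos: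
  assumes T: "probability_tree T \<theta>" and c: "c \<in> arcs (graph (ceg T \<theta>))"
  shows "0 < ceg_prob \<theta> c"
proof -
  have ev: "event_tree T"
    using T by (simp add: probability_tree_def)
  interpret G: fin_digraph "graph T"
    using ev by (simp add: event_tree_def)
  let ?a = "SOME a. a \<in> c"
  have a: "?a \<in> arcs (graph T)"
    by (rule ceg_arc_representative[OF ev c])
  then have "tail (graph T) ?a \<in> internal T" "?a \<in> out_arcs (graph T) (tail (graph T) ?a)"
    by (auto simp: internal_def)
  then show ?thesis
    using T by (auto simp: ceg_prob_def probability_tree_def)
qed

section \<open>Probabilities in the conditioned CEG\<close>

lemma through_edge_subset_intervened_paths:
  assumes "w \<in> ws" "e \<in> out_arcs (graph C) w"
  shows "through_edge C e \<subseteq> intervened_paths C ws"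
proof -
  \<comment> \<open>For a non-empty list, \<open>awalk_verts\<close> consists of the tails of all
    its edges followed by the last head.\<close>
  have "tail (graph C) e \<in> path_verts C p" if "e \<in> set p" for p
    using that by (cases "p = []") (auto simp: path_verts_def pre_digraph.awalk_verts_conv)
  with assms show ?thesis
    by (auto simp: through_edge_def intervened_paths_def through_vertex_def)
qed

lemma pre_prob_nonneg:
  assumes "\<And>e. e \<in> arcs (graph C) \<Longrightarrow> 0 \<le> \<theta> e"
  shows "0 \<le> pre_prob C \<theta> ws A"
proof -
  have "0 \<le> path_prob \<theta> p" if "p \<in> paths C" for p
    using that assms
    by (auto simp: path_prob_def paths_def pre_digraph.awalk_def intro!: prod_nonneg)
  \<comment> \<open>The bound covers every \<open>e\<close>: where the denominator vanishes, the
    quotient is 0 by convention.\<close>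
  then have "0 \<le> cond_transition C ws (path_prob \<theta>) e" for e
    unfolding cond_transition_def
    by (intro divide_nonneg_nonneg sum_nonneg) (auto simp: through_edge_def through_vertex_def)
  then show ?thesis
    by (auto simp: pre_prob_def cond_event_prob_def intro!: sum_nonneg prod_nonneg)
qed

lemma pre_prob_mono:
  assumes "\<And>e. e \<in> arcs (graph C) \<Longrightarrow> 0 \<le> \<theta> e" "A \<subseteq> B" "finite B"
  shows "pre_prob C \<theta> ws A \<le> pre_prob C \<theta> ws B"
proof -
  have "pre_prob C \<theta> ws B = pre_prob C \<theta> ws A + pre_prob C \<theta> ws (B - A)"
    unfolding pre_prob_def cond_event_prob_def
    using assms(2,3) by (subst sum.union_disjoint[symmetric]) (auto intro!: sum.cong intro: finite_subset)
  with pre_prob_nonneg[of C \<theta> ws "B - A"] assms(1) show ?thesis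
    by simp
qed

text \<open>This is additivity over the disjoint cells. Finiteness of \<open>I\<close>, later the
  set of intervened paths, makes \<open>Z\<close> finite, so the sum over the cells is not the
  default value 0.\<close>

lemma pre_prob_partition:
  assumes "finite I" "partition_on I Z" "A \<subseteq> I"
  shows "pre_prob C \<theta> ws A = (\<Sum>\<Lambda>z \<in> Z. pre_prob C \<theta> ws (A \<inter> \<Lambda>z))"
proof -
  have Z: "finite Z" "\<Union>Z = I"
    using assms finite_elements[of I Z] by (auto simp: partition_on_def)
  have cover: "A \<inter> paths (conditioned_ceg C ws) = (\<Union>\<Lambda>z \<in> Z. A \<inter> \<Lambda>z \<inter> paths (conditioned_ceg C ws))"
    using Z assms(3) by blast
  have fin: "\<forall>\<Lambda>z \<in> Z. finite (A \<inter> \<Lambda>z \<inter> paths (conditioned_ceg C ws))"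
    using assms(1,3) by (auto intro: finite_subset)
  have disj: "\<forall>\<Lambda>z \<in> Z. \<forall>\<Lambda>z' \<in> Z. \<Lambda>z \<noteq> \<Lambda>z' \<longrightarrow>
      A \<inter> \<Lambda>z \<inter> paths (conditioned_ceg C ws) \<inter> (A \<inter> \<Lambda>z' \<inter> paths (conditioned_ceg C ws)) = {}"
    using assms(2) by (fastforce simp: partition_on_def disjoint_def)
  show ?thesis
    unfolding pre_prob_def cond_event_prob_def cover
    by (rule sum.UNION_disjoint[OF Z(1) fin disj])
qed

section \<open>Singular manipulations\<close>

text \<open>Each summand conditions on an edge that leaves an intervened position, and the paths
  through that edge are covered by \<open>Z\<close>. Hence the law of total probability applies even
  to an \<open>A\<close> that contains other paths.\<close>

lemma singular_prob_partition:
  assumes fin: "finite (paths C)" and Z: "partition_on (intervened_paths C ws) Z"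
  shows "singular_prob C \<theta> ws x A = (\<Sum>\<Lambda>z \<in> Z. singular_prob C \<theta> ws x (A \<inter> \<Lambda>z))"
proof -
  have finI: "finite (intervened_paths C ws)"
    by (rule finite_subset[OF _ fin]) (auto simp: intervened_paths_def through_vertex_def)
  have split: "pre_cond C \<theta> ws A (through_edge C e)
      = (\<Sum>\<Lambda>z \<in> Z. pre_cond C \<theta> ws (A \<inter> \<Lambda>z) (through_edge C e))"
    if "w \<in> ws" "e \<in> out_arcs (graph C) w" for w e
  proof -
    have "A \<inter> through_edge C e \<subseteq> intervened_paths C ws"
      using through_edge_subset_intervened_paths[OF that] by blast
    from pre_prob_partition[OF finI Z this, of C \<theta> ws] show ?thesis
      by (simp add: pre_cond_def sum_divide_distrib Int_ac)
  qed
  have "singular_prob C \<theta> ws x A =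
    (\<Sum>w \<in> ws. \<Sum>e \<in> {e \<in> out_arcs (graph C) w. devent C e = x}. \<Sum>\<Lambda>z \<in> Z.
        pre_prob C \<theta> ws (through_vertex C w) * pre_cond C \<theta> ws (A \<inter> \<Lambda>z) (through_edge C e))"
    unfolding singular_prob_def
    by (intro sum.cong refl) (auto simp: split sum_distrib_left)
  also have "\<dots> = (\<Sum>w \<in> ws. \<Sum>\<Lambda>z \<in> Z. \<Sum>e \<in> {e \<in> out_arcs (graph C) w. devent C e = x}.
        pre_prob C \<theta> ws (through_vertex C w) * pre_cond C \<theta> ws (A \<inter> \<Lambda>z) (through_edge C e))"
    by (intro sum.cong refl sum.swap)
  also have "\<dots> = (\<Sum>\<Lambda>z \<in> Z. singular_prob C \<theta> ws x (A \<inter> \<Lambda>z))"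
    unfolding singular_prob_def by (rule sum.swap)
  finally show ?thesis .
qed

lemma singular_prob_nonneg:
  assumes "\<And>e. e \<in> arcs (graph C) \<Longrightarrow> 0 \<le> \<theta> e"
  shows "0 \<le> singular_prob C \<theta> ws x A"
  unfolding singular_prob_def pre_cond_def
  by (intro sum_nonneg mult_nonneg_nonneg divide_nonneg_nonneg pre_prob_nonneg assms)

text \<open>This serves to show that a cell of singular probability zero has only null subevents, so
  that a conditional probability can be multiplied by its denominator in all cases.\<close>

lemma singular_prob_mono:
  assumes pos: "\<And>e. e \<in> arcs (graph C) \<Longrightarrow> 0 \<le> \<theta> e" and fin: "finite (paths C)" and "A \<subseteq> B"
  shows "singular_prob C \<theta> ws x A \<le> singular_prob C \<theta> ws x B"
proof -
  have "finite (through_edge C e)" for e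
    by (rule finite_subset[OF _ fin]) (auto simp: through_edge_def)
  then have "pre_cond C \<theta> ws A (through_edge C e) \<le> pre_cond C \<theta> ws B (through_edge C e)" for e
    using \<open>A \<subseteq> B\<close> unfolding pre_cond_def
    by (intro divide_right_mono pre_prob_mono pre_prob_nonneg pos) auto
  then show ?thesis
    unfolding singular_prob_def
    by (intro sum_mono mult_left_mono pre_prob_nonneg pos)
qed

section \<open>Adjustment formula and identifiability\<close>

text \<open>The two sides are matched for each \<open>x\<close> separately. The factor
  \<open>post_prob\<close> does not depend on the cell and is distributed over the sum at the
  end.\<close>

lemma causal_effect_eq_backdoor_adjustment:
  assumes pos: "\<And>e. e \<in> arcs (graph C) \<Longrightarrow> 0 \<le> \<theta> e" and fin: "finite (paths C)"
    and Z: "partition_on (intervened_paths C ws) Z"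
    and cond: "\<forall>x \<in> intervened_devents C ws. \<forall>\<Lambda>z \<in> Z.
      singular_cond C \<theta> ws x (through_devent C y) \<Lambda>z =
        pre_cond C \<theta> ws (through_devent C y) (through_devent C x \<inter> \<Lambda>z)"
    and marg: "\<forall>x \<in> intervened_devents C ws. \<forall>\<Lambda>z \<in> Z.
      singular_prob C \<theta> ws x \<Lambda>z = pre_prob C \<theta> ws \<Lambda>z"
  shows "causal_effect C \<theta> \<theta>h ws y = backdoor_adjustment C \<theta> \<theta>h ws y Z"
proof -
  have "singular_prob C \<theta> ws x (through_devent C y) =
      (\<Sum>\<Lambda>z \<in> Z. pre_cond C \<theta> ws (through_devent C y) (through_devent C x \<inter> \<Lambda>z) * pre_prob C \<theta> ws \<Lambda>z)"
    if x: "x \<in> intervened_devents C ws" for x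
  proof -
    have bounds: "0 \<le> singular_prob C \<theta> ws x (through_devent C y \<inter> \<Lambda>z)"
      "singular_prob C \<theta> ws x (through_devent C y \<inter> \<Lambda>z) \<le> singular_prob C \<theta> ws x \<Lambda>z" for \<Lambda>z
      by (auto intro!: singular_prob_nonneg singular_prob_mono pos fin)
    \<comment> \<open>The product rule survives a zero denominator: \<open>bounds\<close> then
      squeezes the left side to 0.\<close>
    have "singular_prob C \<theta> ws x (through_devent C y \<inter> \<Lambda>z) =
        singular_cond C \<theta> ws x (through_devent C y) \<Lambda>z * singular_prob C \<theta> ws x \<Lambda>z" for \<Lambda>z
      using bounds[of \<Lambda>z]
      by (cases "singular_prob C \<theta> ws x \<Lambda>z = 0") (auto simp: singular_cond_def)
    then show ?thesis
      using x cond marg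
      by (subst singular_prob_partition[OF fin Z]) (auto intro!: sum.cong)
  qed
  then show ?thesis
    by (auto simp: causal_effect_def backdoor_adjustment_def sum_distrib_right intro!: sum.cong)
qed

text \<open>The adjustment formula is built only from probabilities of observable events and from
  the post-intervention probabilities that are taken as known. Models that agree on these give it
  the same value, provided one partition serves all of \<open>K\<close>.\<close>

lemma identifiable_by_backdoor_adjustment:
  assumes obs: "observable_partition C ws y Obs Z"
    and adj: "\<And>\<theta>. \<theta> \<in> K \<Longrightarrow> causal_effect C \<theta> \<theta>h ws y = backdoor_adjustment C \<theta> \<theta>h ws y Z"
  shows "identifiable C K \<theta>h ws y Obs"
  unfolding identifiable_def
proof (intro ballI impI, elim conjE)
  fix \<theta>1 \<theta>2
  assume K: "\<theta>1 \<in> K" "\<theta>2 \<in> K"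
    and pre: "\<forall>A \<in> Obs. pre_prob C \<theta>1 ws A = pre_prob C \<theta>2 ws A"
    and post: "\<forall>x \<in> intervened_devents C ws.
      post_prob C \<theta>1 \<theta>h ws (through_devent C x) = post_prob C \<theta>2 \<theta>h ws (through_devent C x)"
  have "backdoor_adjustment C \<theta>1 \<theta>h ws y Z = backdoor_adjustment C \<theta>2 \<theta>h ws y Z"
    unfolding backdoor_adjustment_def pre_cond_def
    \<comment> \<open>\<open>Int_assoc\<close> reconciles the bracketing of the joint event in
      \<open>pre_cond\<close> with that in \<open>observable_partition\<close>.\<close>
    using obs pre post by (intro sum.cong refl) (simp add: observable_partition_def Int_assoc)
  then show "causal_effect C \<theta>1 \<theta>h ws y = causal_effect C \<theta>2 \<theta>h ws y"
    using adj K by simp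
qed

text \<open>Identifiability compares different members of \<open>K\<close>, so the first and third
  conjuncts ask for one partition that works for the whole class. The second concerns the true
  parameters \<open>\<theta>C\<close> alone.\<close>

theorem theorem4p5:
  fixes T :: "('v, 'b, 'x) event_tree"
    and \<theta> :: "'b \<Rightarrow> real"
    and C :: "('v ceg_vertex, 'b set, 'x) ldigraph"
    and \<theta>C \<theta>h :: "'b set \<Rightarrow> real"
    and ws :: "'v ceg_vertex set"
    and y :: 'x
    and K :: "('b set \<Rightarrow> real) set"
    and Obs :: "'b set list set set"
  assumes tree: "probability_tree T \<theta>"
    and ceg: "C = ceg T \<theta>" "\<theta>C = ceg_prob \<theta>"
    and manip: "stochastic_manipulation C \<theta>C \<theta>h ws"
    and models: "K \<subseteq> compatible_params T \<theta> \<theta>h ws" "\<theta>C \<in> K"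
  shows
   "((\<exists>Z. observable_partition C ws y Obs Z \<and>
          (\<forall>\<theta>' \<in> K. backdoor_partition C \<theta>' ws y Z \<and>
             causal_effect C \<theta>' \<theta>h ws y = backdoor_adjustment C \<theta>' \<theta>h ws y Z))
      \<longrightarrow> identifiable C K \<theta>h ws y Obs)
    \<and>
    (\<forall>Z. backdoor_partition C \<theta>C ws y Z \<and>
         (\<forall>x \<in> intervened_devents C ws. \<forall>\<Lambda>z \<in> Z.
            singular_cond C \<theta>C ws x (through_devent C y) \<Lambda>z =
              pre_cond C \<theta>C ws (through_devent C y) (through_devent C x \<inter> \<Lambda>z)) \<and>
         (\<forall>x \<in> intervened_devents C ws. \<forall>\<Lambda>z \<in> Z.
            singular_prob C \<theta>C ws x \<Lambda>z = pre_prob C \<theta>C ws \<Lambda>z)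
      \<longrightarrow> causal_effect C \<theta>C \<theta>h ws y = backdoor_adjustment C \<theta>C \<theta>h ws y Z)
    \<and>
    ((\<exists>Z. observable_partition C ws y Obs Z \<and>
          (\<forall>\<theta>' \<in> K. backdoor_partition C \<theta>' ws y Z \<and>
             (\<forall>x \<in> intervened_devents C ws. \<forall>\<Lambda>z \<in> Z.
                singular_cond C \<theta>' ws x (through_devent C y) \<Lambda>z =
                  pre_cond C \<theta>' ws (through_devent C y) (through_devent C x \<inter> \<Lambda>z)) \<and>
             (\<forall>x \<in> intervened_devents C ws. \<forall>\<Lambda>z \<in> Z.
                singular_prob C \<theta>' ws x \<Lambda>z = pre_prob C \<theta>' ws \<Lambda>z)))
      \<longrightarrow> identifiable C K \<theta>h ws y Obs)"
proof -
  have fin: "finite (paths C)"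
    using tree finite_paths_ceg by (auto simp: ceg probability_tree_def)
  \<comment> \<open>Proved for every member of \<open>K\<close>, this gives the second conjunct
    through \<open>\<theta>C \<in> K\<close> and supplies the formula for the third.\<close>
  have effect: "causal_effect C \<theta>' \<theta>h ws y = backdoor_adjustment C \<theta>' \<theta>h ws y Z"
    if K: "\<theta>' \<in> K" and Z: "backdoor_partition C \<theta>' ws y Z"
      and cond: "\<forall>x \<in> intervened_devents C ws. \<forall>\<Lambda>z \<in> Z.
         singular_cond C \<theta>' ws x (through_devent C y) \<Lambda>z =
           pre_cond C \<theta>' ws (through_devent C y) (through_devent C x \<inter> \<Lambda>z)"
      and marg: "\<forall>x \<in> intervened_devents C ws. \<forall>\<Lambda>z \<in> Z.
         singular_prob C \<theta>' ws x \<Lambda>z = pre_prob C \<theta>' ws \<Lambda>z" for \<theta>' Z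
  proof (rule causal_effect_eq_backdoor_adjustment[OF _ fin _ cond marg])
    \<comment> \<open>A member of \<open>K\<close> comes from probabilities on the same tree with
      the same stages. They generate the same graph \<open>C\<close>, so positivity on its arcs
      carries over.\<close>
    obtain \<theta>'' where \<theta>'': "\<theta>' = ceg_prob \<theta>''" "probability_tree T \<theta>''"
      "same_stage T \<theta>'' = same_stage T \<theta>"
      using subsetD[OF models(1) K] by (auto simp: compatible_params_def)
    have "C = ceg T \<theta>''"
      using ceg_cong[OF \<theta>''(3)] by (simp add: ceg)
    then show "0 \<le> \<theta>' e" if "e \<in> arcs (graph C)" for e
      using ceg_prob_pos[OF \<theta>''(2)] that by (simp add: \<theta>''(1) less_imp_le)
    show "partition_on (intervened_paths C ws) Z"
      using Z by (simp add: backdoor_partition_def)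
  qed
  show ?thesis
  proof (intro conjI impI allI)
    assume "\<exists>Z. observable_partition C ws y Obs Z \<and>
          (\<forall>\<theta>' \<in> K. backdoor_partition C \<theta>' ws y Z \<and>
             causal_effect C \<theta>' \<theta>h ws y = backdoor_adjustment C \<theta>' \<theta>h ws y Z)"
    then obtain Z where "observable_partition C ws y Obs Z"
      "\<forall>\<theta>' \<in> K. causal_effect C \<theta>' \<theta>h ws y = backdoor_adjustment C \<theta>' \<theta>h ws y Z"
      by auto
    then show "identifiable C K \<theta>h ws y Obs"
      by (auto intro: identifiable_by_backdoor_adjustment)
  next
    fix Z
    assume "backdoor_partition C \<theta>C ws y Z \<and>
         (\<forall>x \<in> intervened_devents C ws. \<forall>\<Lambda>z \<in> Z.
            singular_cond C \<theta>C ws x (through_devent C y) \<Lambda>z =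
              pre_cond C \<theta>C ws (through_devent C y) (through_devent C x \<inter> \<Lambda>z)) \<and>
         (\<forall>x \<in> intervened_devents C ws. \<forall>\<Lambda>z \<in> Z.
            singular_prob C \<theta>C ws x \<Lambda>z = pre_prob C \<theta>C ws \<Lambda>z)"
    then show "causal_effect C \<theta>C \<theta>h ws y = backdoor_adjustment C \<theta>C \<theta>h ws y Z"
      by (elim conjE) (rule effect[OF models(2)])
  next
    assume "\<exists>Z. observable_partition C ws y Obs Z \<and>
          (\<forall>\<theta>' \<in> K. backdoor_partition C \<theta>' ws y Z \<and>
             (\<forall>x \<in> intervened_devents C ws. \<forall>\<Lambda>z \<in> Z.
                singular_cond C \<theta>' ws x (through_devent C y) \<Lambda>z =
                  pre_cond C \<theta>' ws (through_devent C y) (through_devent C x \<inter> \<Lambda>z)) \<and>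
             (\<forall>x \<in> intervened_devents C ws. \<forall>\<Lambda>z \<in> Z.
                singular_prob C \<theta>' ws x \<Lambda>z = pre_prob C \<theta>' ws \<Lambda>z))"
    then obtain Z where obs: "observable_partition C ws y Obs Z"
      and Z: "\<forall>\<theta>' \<in> K. backdoor_partition C \<theta>' ws y Z \<and>
         (\<forall>x \<in> intervened_devents C ws. \<forall>\<Lambda>z \<in> Z.
            singular_cond C \<theta>' ws x (through_devent C y) \<Lambda>z =
              pre_cond C \<theta>' ws (through_devent C y) (through_devent C x \<inter> \<Lambda>z)) \<and>
         (\<forall>x \<in> intervened_devents C ws. \<forall>\<Lambda>z \<in> Z.
            singular_prob C \<theta>' ws x \<Lambda>z = pre_prob C \<theta>' ws \<Lambda>z)"
      by (elim exE conjE)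
    show "identifiable C K \<theta>h ws y Obs"
    proof (rule identifiable_by_backdoor_adjustment[OF obs])
      fix \<theta>'
      assume K: "\<theta>' \<in> K"
      from bspec[OF Z K]
      show "causal_effect C \<theta>' \<theta>h ws y = backdoor_adjustment C \<theta>' \<theta>h ws y Z"
        by (elim conjE) (rule effect[OF K])
    qed
  qed
qed

end
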